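(* Let $n\ge 2$ and let $\mathcal{S}$ be a set of pairwise nonisomorphic loopless frameless powerful sets of order $n$ (i.e. subsets of $\mathbb{F}_2^n$) and size $2^{n-2}$. Let $\mathcal{S}^{\diamond 2}:=\{S_1\diamond S_2\mid S_1,S_2\in\mathcal{S}\}$. Then every member of $\mathcal{S}^{\diamond2}$ is a loopless frameless powerful set of order $n+3$ and size $2^{n+1}$, and these sets are pairwise nonisomorphic, in the sense that for $S_1,S_2,S_1',S_2'\in\mathcal{S}$, if $S_1\diamond S_2\cong S_1'\diamond S_2'$ then $S_1\cong S_1'$ and $S_2\cong S_2'$. Moreover, if $n>3$, then every member of $\mathcal{S}^{\diamond2}$ is nonlinear (not a linear subspace).
   Context: A set $S\subseteq\mathbb{F}_2^n$ (positions indexed by $[n]$; $n$ is its order) is a powerful set if for every $X\subseteq[n]$ the number of vectors in $S$ that are zero in all positions of $X$ is a power of $2$. A position $e$ is a loop of $S$ if every vector of $S$ is $0$ at $e$; $e$ is a frame of $S$ if $\mathbf{0}\in S$, the unit vector with a single $1$ at $e$ is not in $S$, and every nonzero vector of $S$ is $1$ at $e$. $S$ is loopless (frameless) if it has no loop (frame). Two sets $S\subseteq\mathbb{F}_2^{E}$, $S'\subseteq\mathbb{F}_2^{E'}$ are isomorphic, $S\cong S'$, if some bijection $E\to E'$ of coordinate positions induces a bijection from $S$ to $S'$. For $S_1,S_2\subseteq\mathbb{F}_2^n$, with $A:=\{\mathbf{v}0\mid\mathbf{v}\in S_1\}$ and $B:=\{\mathbf{0}_n0\}\cup\{\mathbf{v}1\mid\mathbf{v}\in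 S_2\setminus\{\mathbf{0}_n\}\}$ in $\mathbb{F}_2^{n+1}$ (juxtaposition = appending bits), \[S_1\diamond S_2:=\{\mathbf{w}00\mid \mathbf{w}\in A\cap B\}\cup\{\mathbf{w}01\mid \mathbf{w}\in A\setminus B\}\cup\{\mathbf{w}10\mid \mathbf{w}\in B\setminus A\}\cup\{\mathbf{w}11\mid \mathbf{w}\in\mathbb{F}_2^{n+1}\setminus(A\cup B)\}\subseteq\mathbb{F}_2^{n+3}.\] *)

theory Defs
  imports "HOL-Library.Z2" "Jordan_Normal_Form.VS_Connect"
begin

text \<open>
  A vector of \<open>\<bbbF>\<^sub>2\<^sup>n\<close> is an element of \<^term>\<open>carrier_vec n :: bit vec set\<close>; its positions
  are \<open>{..<n}\<close> (counted from 0) rather than \<open>{1..n}\<close>. Since a set of vectors does not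
  determine its order (think of the empty set), the order is an explicit argument throughout.
\<close>

definition powerful_set :: "nat \<Rightarrow> bit vec set \<Rightarrow> bool" where
  "powerful_set n S \<longleftrightarrow> S \<subseteq> carrier_vec n \<and>
     (\<forall>X \<subseteq> {..<n}. \<exists>k::nat. card {v \<in> S. \<forall>i \<in> X. v $ i = 0} = 2 ^ k)"

definition loop_of :: "nat \<Rightarrow> bit vec set \<Rightarrow> nat \<Rightarrow> bool" where
  "loop_of n S e \<longleftrightarrow> e < n \<and> (\<forall>v \<in> S. v $ e = 0)"

definition frame_of :: "nat \<Rightarrow> bit vec set \<Rightarrow> nat \<Rightarrow> bool" where
  "frame_of n S e \<longleftrightarrow> e < n \<and> 0\<^sub>v n \<in> S \<and> unit_vec n e \<notin> S \<and>
     (\<forall>v \<in> S. v \<noteq> 0\<^sub>v n \<longrightarrow> v $ e = 1)"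

definition loopless :: "nat \<Rightarrow> bit vec set \<Rightarrow> bool" where
  "loopless n S \<longleftrightarrow> (\<nexists>e. loop_of n S e)"

definition frameless :: "nat \<Rightarrow> bit vec set \<Rightarrow> bool" where
  "frameless n S \<longleftrightarrow> (\<nexists>e. frame_of n S e)"

text \<open>
  A bijection \<open>\<pi>\<close> of positions \<open>{..<n} \<rightarrow> {..<m}\<close> moves the entry at position \<open>i\<close> to position
  \<open>\<pi> i\<close>, i.e. it sends \<open>v\<close> to \<open>v \<circ> \<pi>\<inverse>\<close>.
\<close>

definition relabel :: "nat \<Rightarrow> nat \<Rightarrow> (nat \<Rightarrow> nat) \<Rightarrow> bit vec \<Rightarrow> bit vec" where
  "relabel n m \<pi> v = vec m (\<lambda>j. v $ inv_into {..<n} \<pi> j)"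

definition isomorphic_sets :: "nat \<Rightarrow> bit vec set \<Rightarrow> nat \<Rightarrow> bit vec set \<Rightarrow> bool" where
  "isomorphic_sets n S m S' \<longleftrightarrow>
     (\<exists>\<pi>. bij_betw \<pi> {..<n} {..<m} \<and> bij_betw (relabel n m \<pi>) S S')"

definition pairwise_nonisomorphic :: "nat \<Rightarrow> bit vec set set \<Rightarrow> bool" where
  "pairwise_nonisomorphic n \<S> \<longleftrightarrow>
     (\<forall>S \<in> \<S>. \<forall>S' \<in> \<S>. S \<noteq> S' \<longrightarrow> \<not> isomorphic_sets n S n S')"

definition append_bits :: "bit vec \<Rightarrow> bit list \<Rightarrow> bit vec" where
  "append_bits v bs = v @\<^sub>v vec_of_list bs"

definition diamond_A :: "bit vec set \<Rightarrow> bit vec set" where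
  "diamond_A S\<^sub>1 = {append_bits v [0] | v. v \<in> S\<^sub>1}"

definition diamond_B :: "nat \<Rightarrow> bit vec set \<Rightarrow> bit vec set" where
  "diamond_B n S\<^sub>2 = {append_bits (0\<^sub>v n) [0]} \<union> {append_bits v [1] | v. v \<in> S\<^sub>2 - {0\<^sub>v n}}"

definition diamond :: "nat \<Rightarrow> bit vec set \<Rightarrow> bit vec set \<Rightarrow> bit vec set" where
  "diamond n S\<^sub>1 S\<^sub>2 =
     (let A = diamond_A S\<^sub>1; B = diamond_B n S\<^sub>2 in
        {append_bits w [0, 0] | w. w \<in> A \<inter> B} \<union>
        {append_bits w [0, 1] | w. w \<in> A - B} \<union>
        {append_bits w [1, 0] | w. w \<in> B - A} \<union>
        {append_bits w [1, 1] | w. w \<in> carrier_vec (n + 1) - (A \<union> B)})"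

definition diamond_square :: "nat \<Rightarrow> bit vec set set \<Rightarrow> bit vec set set" where
  "diamond_square n \<S> = {diamond n S\<^sub>1 S\<^sub>2 | S\<^sub>1 S\<^sub>2. S\<^sub>1 \<in> \<S> \<and> S\<^sub>2 \<in> \<S>}"

definition linear_set :: "nat \<Rightarrow> bit vec set \<Rightarrow> bool" where
  "linear_set n S \<longleftrightarrow> subspace class_ring S (module_vec TYPE(bit) n)"

end

theory Submission
  imports Defs
begin

text \<open>
  The diamond is the graph over \<open>\<bbbF>\<^sub>2\<^sup>n\<^sup>+\<^sup>1\<close> of the complemented indicators of \<open>A\<close> and \<open>B\<close>, which meet
  only in \<open>0\<close>. Hence requiring a zero at the first (second) indicator position leaves a copy of \<open>S\<^sub>1\<close>
  (of \<open>S\<^sub>2\<close>), which gives powerfulness.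

  An isomorphism of diamonds has to fix the last three positions: \<open>(n + 1, n)\<close> is the only pair of
  distinct positions \<open>(p, e)\<close> such that a zero at \<open>p\<close> forces a zero at \<open>e\<close>, and \<open>n + 2\<close> is the only
  further position at which a zero, together with a zero at \<open>n\<close>, forces the whole vector to vanish.
  The isomorphism therefore restricts to the first \<open>n\<close> positions and carries factors to factors.

  For nonlinearity, distinct nonzero \<open>x\<close>, \<open>y\<close> in \<open>S\<^sub>1\<close> yield the vectors \<open>x001\<close> and \<open>y001\<close>, whose sum
  ends in \<open>000\<close> although it is nonzero.
\<close>

section \<open>Vectors with one or three appended bits\<close>

lemma append_bits3_index:
  assumes "u \<in> carrier_vec n"
  shows "i < n \<Longrightarrow> append_bits u [a, b, c] $ i = u $ i"
    and "append_bits u [a, b, c] $ n = a"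
    and "append_bits u [a, b, c] $ Suc n = b"
    and "append_bits u [a, b, c] $ Suc (Suc n) = c"
  using assms by (auto simp: append_bits_def vec_of_list_index simp del: vec_of_list_Cons)

lemma append_bits_carrier:
  "u \<in> carrier_vec n \<Longrightarrow> append_bits u bs \<in> carrier_vec (n + length bs)"
  by (auto simp: append_bits_def intro!: carrier_vecI)

lemma append_bits3_carrier:
  "u \<in> carrier_vec n \<Longrightarrow> append_bits u [a, b, c] \<in> carrier_vec (n + 3)"
  using append_bits_carrier[of u n "[a, b, c]"] by (simp add: numeral_3_eq_3)

lemma append_bits3_inject:
  assumes "u \<in> carrier_vec n" "u' \<in> carrier_vec n"
  shows "append_bits u [a, b, c] = append_bits u' [a', b', c'] \<longleftrightarrow>
    u = u' \<and> a = a' \<and> b = b' \<and> c = c'"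
proof
  assume eq: "append_bits u [a, b, c] = append_bits u' [a', b', c']"
  have "u $ i = u' $ i" if "i < n" for i
    using append_bits3_index(1)[OF assms(1) that] append_bits3_index(1)[OF assms(2) that] eq by metis
  then have "u = u'" using assms by auto
  then show "u = u' \<and> a = a' \<and> b = b' \<and> c = c'"
    using append_bits3_index(2-4)[OF assms(1), of a b c] append_bits3_index(2-4)[OF assms(2), of a' b' c'] eq
    by metis
qed simp

lemma append_bits3_exhaust:
  assumes "v \<in> carrier_vec (n + 3)"
  obtains u a b c where "u \<in> carrier_vec n" "v = append_bits u [a, b, c]"
proof
  show "vec n (\<lambda>i. v $ i) \<in> carrier_vec n" by simp
  show "v = append_bits (vec n (\<lambda>i. v $ i)) [v $ n, v $ Suc n, v $ Suc (Suc n)]"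
  proof (rule eq_vecI)
    show "dim_vec v = dim_vec (append_bits (vec n (\<lambda>i. v $ i)) [v $ n, v $ Suc n, v $ Suc (Suc n)])"
      using assms by (simp add: append_bits_def)
    fix i assume "i < dim_vec (append_bits (vec n (\<lambda>i. v $ i)) [v $ n, v $ Suc n, v $ Suc (Suc n)])"
    then have "i < n \<or> i = n \<or> i = Suc n \<or> i = Suc (Suc n)" by (auto simp: append_bits_def)
    then show "v $ i = append_bits (vec n (\<lambda>i. v $ i)) [v $ n, v $ Suc n, v $ Suc (Suc n)] $ i"
      by (auto simp: append_bits3_index[of _ n])
  qed
qed

lemma append_bits3_eq_zero_iff:
  assumes "u \<in> carrier_vec n"
  shows "append_bits u [a, b, c] = 0\<^sub>v (n + 3) \<longleftrightarrow> u = 0\<^sub>v n \<and> a = 0 \<and> b = 0 \<and> c = 0"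
proof -
  have "append_bits (0\<^sub>v n) [0, 0, 0] = 0\<^sub>v (n + 3)"
    by (rule eq_vecI) (auto simp: append_bits_def vec_of_list_index less_Suc_eq numeral_eq_Suc nth_Cons split: nat.split)
  then show ?thesis using append_bits3_inject[OF assms zero_carrier_vec] by metis
qed

text \<open>The diamond appends one bit and then two more; merging them lets every vector be treated
  as a prefix of length \<open>n\<close> with three final bits.\<close>

lemma append_bits_append:
  assumes "u \<in> carrier_vec n"
  shows "append_bits (append_bits u [a]) [b, c] = append_bits u [a, b, c]"
  by (rule eq_vecI) (use assms in \<open>auto simp: append_bits_def vec_of_list_index nth_Cons' simp del: vec_of_list_Cons\<close>)

text \<open>Padding both sides with two fixed bits gives the three-bit case.\<close>

lemma append_bits1_inject:
  assumes "u \<in> carrier_vec n" "u' \<in> carrier_vec n"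
  shows "append_bits u [a] = append_bits u' [a'] \<longleftrightarrow> u = u' \<and> a = a'"
  using append_bits3_inject[OF assms, of a 0 0 a' 0 0] append_bits_append[OF assms(1), of a 0 0]
    append_bits_append[OF assms(2), of a' 0 0] by metis

lemma append_bits1_exhaust:
  assumes "w \<in> carrier_vec (n + 1)"
  obtains u a where "u \<in> carrier_vec n" "w = append_bits u [a]"
proof
  show "vec n (\<lambda>i. w $ i) \<in> carrier_vec n" by simp
  show "w = append_bits (vec n (\<lambda>i. w $ i)) [w $ n]"
    by (rule eq_vecI) (use assms in \<open>auto simp: append_bits_def vec_of_list_index less_Suc_eq\<close>)
qed

section \<open>Membership in the diamond\<close>

lemma diamond_A_carrier: "S\<^sub>1 \<subseteq> carrier_vec n \<Longrightarrow> diamond_A S\<^sub>1 \<subseteq> carrier_vec (n + 1)"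
  using append_bits_carrier[of _ n "[0]"] by (fastforce simp: diamond_A_def)

lemma diamond_B_carrier: "S\<^sub>2 \<subseteq> carrier_vec n \<Longrightarrow> diamond_B n S\<^sub>2 \<subseteq> carrier_vec (n + 1)"
  using append_bits_carrier[of _ n "[1]"] append_bits_carrier[of "0\<^sub>v n" n "[0]"]
  by (fastforce simp: diamond_B_def)

lemma append_bits_in_diamond_A:
  assumes "S\<^sub>1 \<subseteq> carrier_vec n" "u \<in> carrier_vec n"
  shows "append_bits u [a] \<in> diamond_A S\<^sub>1 \<longleftrightarrow> u \<in> S\<^sub>1 \<and> a = 0"
  using assms by (auto simp: diamond_A_def append_bits1_inject[of _ n] subset_iff)

lemma append_bits_in_diamond_B:
  assumes "S\<^sub>2 \<subseteq> carrier_vec n" "u \<in> carrier_vec n"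
  shows "append_bits u [a] \<in> diamond_B n S\<^sub>2 \<longleftrightarrow>
    (if u = 0\<^sub>v n then a = 0 else u \<in> S\<^sub>2 \<and> a = 1)"
  using assms by (auto simp: diamond_B_def append_bits1_inject[of _ n] subset_iff)

text \<open>The four pieces of the definition correspond to the four truth values of membership in A
  and in B, so \<open>u\<close> and \<open>a\<close> determine \<open>b\<close> and
  \<open>c\<close>. Later membership arguments reduce to this criterion.\<close>

lemma append_bits_in_diamond_iff:
  assumes S1: "S\<^sub>1 \<subseteq> carrier_vec n" and S2: "S\<^sub>2 \<subseteq> carrier_vec n" and u: "u \<in> carrier_vec n"
  shows "append_bits u [a, b, c] \<in> diamond n S\<^sub>1 S\<^sub>2 \<longleftrightarrow>
    b = (if u \<in> S\<^sub>1 \<and> a = 0 then 0 else 1) \<and>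
    c = (if (if u = 0\<^sub>v n then a = 0 else u \<in> S\<^sub>2 \<and> a = 1) then 0 else 1)"
proof -
  let ?A = "diamond_A S\<^sub>1" and ?B = "diamond_B n S\<^sub>2"
  note AC = diamond_A_carrier[OF S1] and BC = diamond_B_carrier[OF S2]
  have uc: "append_bits u [a] \<in> carrier_vec (n + 1)"
    using append_bits_carrier[OF u, of "[a]"] by simp
  have inj: "append_bits u [a, b, c] = append_bits w [b', c'] \<longleftrightarrow> w = append_bits u [a] \<and> b = b' \<and> c = c'"
    if w: "w \<in> carrier_vec (n + 1)" for w b' c'
  proof -
    obtain u' a' where "u' \<in> carrier_vec n" "w = append_bits u' [a']"
      using append_bits1_exhaust[OF w] .
    then show ?thesis
      by (auto simp: append_bits_append[of _ n] append_bits3_inject[of _ n] append_bits1_inject[of _ n] u)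
  qed
  \<comment> \<open>This evaluates each of the four comprehensions in the definition at one vector
    with three appended bits.\<close>
  have ex: "(\<exists>w. append_bits u [a, b, c] = append_bits w [b', c'] \<and> w \<in> W) \<longleftrightarrow>
      append_bits u [a] \<in> W \<and> b = b' \<and> c = c'" if "W \<subseteq> carrier_vec (n + 1)" for W b' c'
    using that inj by blast
  have "append_bits u [a, b, c] \<in> diamond n S\<^sub>1 S\<^sub>2 \<longleftrightarrow>
    b = (if append_bits u [a] \<in> ?A then 0 else 1) \<and> c = (if append_bits u [a] \<in> ?B then 0 else 1)"
    unfolding diamond_def Let_def Un_iff mem_Collect_eq
    using AC BC uc by (subst (1 2 3 4) ex) (auto split: if_splits)
  then show ?thesis
    by (simp add: append_bits_in_diamond_A[OF S1 u] append_bits_in_diamond_B[OF S2 u])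
qed

lemma diamond_carrier:
  assumes "S\<^sub>1 \<subseteq> carrier_vec n" "S\<^sub>2 \<subseteq> carrier_vec n"
  shows "diamond n S\<^sub>1 S\<^sub>2 \<subseteq> carrier_vec (n + 3)"
proof
  have c: "append_bits w [b, c] \<in> carrier_vec (n + 3)" if "w \<in> carrier_vec (n + 1)" for w b c
    using append_bits_carrier[OF that, of "[b, c]"] by (simp add: numeral_3_eq_3)
  fix v assume "v \<in> diamond n S\<^sub>1 S\<^sub>2"
  then obtain w b c where "v = append_bits w [b, c]" "w \<in> carrier_vec (n + 1)"
    using diamond_A_carrier[OF assms(1)] diamond_B_carrier[OF assms(2)]
    unfolding diamond_def Let_def by blast
  then show "v \<in> carrier_vec (n + 3)" using c by simp
qed

section \<open>Counting members that vanish on given positions, and powerfulness\<close>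

lemma ball_positions3:
  assumes "X \<subseteq> {..<n + 3}" "u \<in> carrier_vec n"
  shows "(\<forall>i\<in>X. append_bits u [a, b, c] $ i = 0) \<longleftrightarrow>
    (\<forall>i\<in>X \<inter> {..<n}. u $ i = 0) \<and> (n \<in> X \<longrightarrow> a = 0) \<and> (n + 1 \<in> X \<longrightarrow> b = 0) \<and> (n + 2 \<in> X \<longrightarrow> c = 0)"
    (is "_ \<longleftrightarrow> ?R")
proof
  assume h: "\<forall>i\<in>X. append_bits u [a, b, c] $ i = 0"
  show ?R
    using bspec[OF h] append_bits3_index[OF assms(2), where a = a and b = b and c = c] by fastforce
next
  assume r: ?R
  show "\<forall>i\<in>X. append_bits u [a, b, c] $ i = 0"
  proof
    fix i assume i: "i \<in> X"
    then have "i < n \<or> i = n \<or> i = n + 1 \<or> i = n + 2" using assms(1) by fastforce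
    then show "append_bits u [a, b, c] $ i = 0"
      using r i append_bits3_index[OF assms(2), where a = a and b = b and c = c] by auto
  qed
qed

text \<open>A bit vector is determined by its support, which may be any set of positions avoiding
  \<open>X\<close>. The guard \<open>i < n\<close> allows \<open>X\<close> to be a set of positions
  of the longer diamond vectors.\<close>

lemma card_vanishing_vecs:
  "card {u \<in> (carrier_vec n :: bit vec set). \<forall>i\<in>X. i < n \<longrightarrow> u $ i = 0} = 2 ^ card ({..<n} - X)"
proof -
  let ?Z = "{u \<in> (carrier_vec n :: bit vec set). \<forall>i\<in>X. i < n \<longrightarrow> u $ i = 0}"
  have "bij_betw (\<lambda>u. {i. i < n \<and> u $ i = 1}) ?Z (Pow ({..<n} - X))"
    by (rule bij_betw_byWitness[where f' = "\<lambda>Y. vec n (\<lambda>i. if i \<in> Y then 1 else 0)"])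
      (auto split: if_splits)
  then show ?thesis by (simp add: bij_betw_same_card card_Pow)
qed

lemma card_carrier_vec_bit: "card (carrier_vec n :: bit vec set) = 2 ^ n"
  using card_vanishing_vecs[of n "{}"] by simp

lemma finite_carrier_vec_bit: "finite (carrier_vec n :: bit vec set)"
  using card_carrier_vec_bit[of n] card.infinite by fastforce

text \<open>Taking all positions for \<open>X\<close> counts only the zero vector, and a power of 2
  is not 0.\<close>

lemma powerful_set_zero:
  assumes "powerful_set n S"
  shows "0\<^sub>v n \<in> S"
proof -
  from assms obtain k :: nat where "card {v \<in> S. \<forall>i\<in>{..<n}. v $ i = 0} = 2 ^ k"
    unfolding powerful_set_def by blast
  then have "{v \<in> S. \<forall>i\<in>{..<n}. v $ i = 0} \<noteq> {}" by (metis card.empty power_not_zero zero_neq_numeral)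
  then obtain v where v: "v \<in> S" "\<forall>i<n. v $ i = 0" by auto
  moreover have "v \<in> carrier_vec n" using assms v(1) by (auto simp: powerful_set_def)
  ultimately have "v = 0\<^sub>v n" by auto
  with v show ?thesis by simp
qed

text \<open>With no condition on the two indicator positions, the count is that of the prefixes of
  length \<open>n + 1\<close> vanishing on \<open>X\<close>, because each prefix has exactly one
  completion. The map \<open>?f\<close> is this completion. The case of empty \<open>X\<close> gives
  the size of the diamond.\<close>

lemma card_vanishing_diamond_free:
  assumes S: "S\<^sub>1 \<subseteq> carrier_vec n" "S\<^sub>2 \<subseteq> carrier_vec n"
    and X: "X \<subseteq> {..<n + 3}" "n + 1 \<notin> X" "n + 2 \<notin> X"
  shows "card {v \<in> diamond n S\<^sub>1 S\<^sub>2. \<forall>i\<in>X. v $ i = 0} = 2 ^ card ({..<n + 1} - X)"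
proof -
  let ?T = "diamond n S\<^sub>1 S\<^sub>2"
  let ?U = "{u \<in> (carrier_vec n :: bit vec set). \<forall>i\<in>X. i < n \<longrightarrow> u $ i = 0}"
  let ?f = "\<lambda>(u, a). append_bits u [a, if u \<in> S\<^sub>1 \<and> a = 0 then 0 else 1,
    if (if u = 0\<^sub>v n then a = 0 else u \<in> S\<^sub>2 \<and> a = 1) then 0 else 1]"
  let ?C = "{a::bit. n \<in> X \<longrightarrow> a = 0}"
  have im: "{v \<in> ?T. \<forall>i\<in>X. v $ i = 0} = ?f ` (?U \<times> ?C)"
  proof (intro Set.set_eqI iffI)
    fix v assume v: "v \<in> {v \<in> ?T. \<forall>i\<in>X. v $ i = 0}"
    then have "v \<in> carrier_vec (n + 3)" using diamond_carrier[OF S] by auto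
    then obtain u a b c where u: "u \<in> carrier_vec n" "v = append_bits u [a, b, c]"
      by (rule append_bits3_exhaust)
    have "(u, a) \<in> ?U \<times> ?C" "v = ?f (u, a)"
      using v unfolding u(2) by (auto simp: u(1) append_bits_in_diamond_iff[OF S] ball_positions3[OF X(1) u(1)])
    then show "v \<in> ?f ` (?U \<times> ?C)" by (rule rev_image_eqI)
  next
    fix v assume "v \<in> ?f ` (?U \<times> ?C)"
    then obtain u a where u: "u \<in> ?U" and a: "a \<in> ?C" and v: "v = ?f (u, a)" by blast
    have uc: "u \<in> carrier_vec n" using u by simp
    have "\<forall>i\<in>X. v $ i = 0"
      unfolding v prod.case ball_positions3[OF X(1) uc] using u a X by simp
    moreover have "v \<in> ?T" unfolding v prod.case append_bits_in_diamond_iff[OF S uc] by simp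
    ultimately show "v \<in> {v \<in> ?T. \<forall>i\<in>X. v $ i = 0}" by simp
  qed
  have "inj_on ?f (?U \<times> ?C)"
    by (rule inj_onI) (auto simp: append_bits3_inject[of _ n])
  then have "card {v \<in> ?T. \<forall>i\<in>X. v $ i = 0} = card ?U * card ?C"
    unfolding im by (simp add: card_image card_cartesian_product)
  moreover have "card ?C = (if n \<in> X then 1 else 2)"
  proof -
    have "card (UNIV :: bit set) = card {0 :: bit, 1}"
      by (rule arg_cong[of _ _ card]) auto
    then show ?thesis by (cases "n \<in> X") simp_all
  qed
  \<comment> \<open>The choice of \<open>a\<close> doubles the count exactly when \<open>n\<close>
    is a free position, which matches the extra element here.\<close>
  moreover have "{..<n + 1} - X = (if n \<in> X then {..<n} - X else insert n ({..<n} - X))"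
    by (auto simp: less_Suc_eq)
  ultimately show ?thesis by (simp add: card_vanishing_vecs)
qed

text \<open>Depending on which of the last three positions must vanish, the surviving members
  correspond to all free prefixes, to the members of \<open>S\<^sub>1\<close> vanishing on the part
  of \<open>X\<close> below \<open>n\<close>, to the zero vector alone, or to such members of
  \<open>S\<^sub>2\<close>.\<close>

lemma powerful_diamond:
  assumes P1: "powerful_set n S\<^sub>1" and P2: "powerful_set n S\<^sub>2"
  shows "powerful_set (n + 3) (diamond n S\<^sub>1 S\<^sub>2)"
  unfolding powerful_set_def
proof (intro conjI allI impI)
  have S: "S\<^sub>1 \<subseteq> carrier_vec n" "S\<^sub>2 \<subseteq> carrier_vec n" using assms by (auto simp: powerful_set_def)
  have z: "0\<^sub>v n \<in> S\<^sub>1" "0\<^sub>v n \<in> S\<^sub>2" using assms by (auto intro: powerful_set_zero)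
  let ?T = "diamond n S\<^sub>1 S\<^sub>2"
  show "?T \<subseteq> carrier_vec (n + 3)" by (rule diamond_carrier[OF S])
  fix X assume X: "X \<subseteq> {..<n + 3}"
  let ?Z = "{v \<in> ?T. \<forall>i\<in>X. v $ i = 0}"
  let ?U = "\<lambda>S. {u \<in> S. \<forall>i\<in>X \<inter> {..<n}. u $ i = 0}"
  have memZ: "append_bits u [a, b, c] \<in> ?Z \<longleftrightarrow> append_bits u [a, b, c] \<in> ?T \<and>
      (\<forall>i\<in>X \<inter> {..<n}. u $ i = 0) \<and> (n \<in> X \<longrightarrow> a = 0) \<and> (n + 1 \<in> X \<longrightarrow> b = 0) \<and> (n + 2 \<in> X \<longrightarrow> c = 0)"
    if "u \<in> carrier_vec n" for u a b c
    using ball_positions3[OF X that] by blast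
  \<comment> \<open>Both sets consist of vectors of length \<open>n + 3\<close>, so it suffices to
    compare them on vectors with three appended bits.\<close>
  have Zeq: "?Z = W" if "W \<subseteq> carrier_vec (n + 3)"
    "\<And>u a b c. u \<in> carrier_vec n \<Longrightarrow> append_bits u [a, b, c] \<in> ?Z \<longleftrightarrow> append_bits u [a, b, c] \<in> W" for W
  proof (rule Set.set_eqI)
    fix v
    show "v \<in> ?Z \<longleftrightarrow> v \<in> W"
    proof (cases "v \<in> carrier_vec (n + 3)")
      case True
      then obtain u a b c where "u \<in> carrier_vec n" "v = append_bits u [a, b, c]"
        by (rule append_bits3_exhaust)
      then show ?thesis using that(2) by blast
    next
      case False
      then show ?thesis using diamond_carrier[OF S] that(1) by blast
    qed
  qed
  consider "n + 1 \<notin> X" "n + 2 \<notin> X" | "n + 1 \<in> X" "n + 2 \<notin> X"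
    | "n + 2 \<in> X" "n + 1 \<in> X \<or> n \<in> X" | "n + 2 \<in> X" "n + 1 \<notin> X" "n \<notin> X" by blast
  then show "\<exists>k::nat. card ?Z = 2 ^ k"
  proof cases
    case 1
    then show ?thesis using card_vanishing_diamond_free[OF S X] by blast
  next
    case 2
    \<comment> \<open>A zero at \<open>n + 1\<close> puts the prefix into A, so \<open>u\<close> is
      in \<open>S\<^sub>1\<close> and \<open>a = 0\<close>. Such a prefix lies in B only if it is
      zero, which fixes the last bit.\<close>
    let ?f = "\<lambda>u. append_bits u [0, 0, if u = 0\<^sub>v n then 0 else 1]"
    have "?Z = ?f ` ?U S\<^sub>1"
    proof (rule Zeq)
      show "?f ` ?U S\<^sub>1 \<subseteq> carrier_vec (n + 3)" using S by (auto intro!: append_bits3_carrier)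
      fix u :: "bit vec" and a b c assume u: "u \<in> carrier_vec n"
      have "append_bits u [a, b, c] \<in> ?f ` ?U S\<^sub>1 \<longleftrightarrow>
          u \<in> ?U S\<^sub>1 \<and> a = 0 \<and> b = 0 \<and> c = (if u = 0\<^sub>v n then 0 else 1)"
        using S(1) u by (auto simp: image_iff append_bits3_inject[of _ n] subset_iff)
      then show "append_bits u [a, b, c] \<in> ?Z \<longleftrightarrow> append_bits u [a, b, c] \<in> ?f ` ?U S\<^sub>1"
        unfolding memZ[OF u] append_bits_in_diamond_iff[OF S u] using 2 by (auto split: if_splits)
    qed
    moreover have "inj_on ?f (?U S\<^sub>1)"
      by (rule inj_onI) (use S in \<open>auto simp: append_bits3_inject[of _ n] subset_iff\<close>)
    ultimately have "card ?Z = card (?U S\<^sub>1)" by (simp add: card_image)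
    then show ?thesis using P1 unfolding powerful_set_def by simp
  next
    case 3
    \<comment> \<open>A zero at \<open>n + 2\<close> puts the prefix into B. A zero at
      \<open>n + 1\<close> or at \<open>n\<close> forces \<open>a = 0\<close>, and the only member
      of B ending in 0 is the zero vector.\<close>
    have "?Z = {append_bits (0\<^sub>v n) [0, 0, 0]}"
    proof (rule Zeq)
      show "{append_bits (0\<^sub>v n) [0, 0, 0]} \<subseteq> carrier_vec (n + 3)" by (auto intro!: append_bits3_carrier)
      fix u :: "bit vec" and a b c assume u: "u \<in> carrier_vec n"
      show "append_bits u [a, b, c] \<in> ?Z \<longleftrightarrow> append_bits u [a, b, c] \<in> {append_bits (0\<^sub>v n) [0, 0, 0]}"
        unfolding memZ[OF u] append_bits_in_diamond_iff[OF S u] singleton_iff append_bits3_inject[OF u zero_carrier_vec]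
        using 3 z by (auto split: if_splits)
    qed
    then have "card ?Z = 2 ^ 0" by simp
    then show ?thesis ..
  next
    case 4
    \<comment> \<open>In B the bit \<open>a\<close> records whether \<open>u\<close> is nonzero. The
      bit \<open>b\<close> agrees with it: zero lies in A, and prefixes ending in 1 do not.\<close>
    let ?h = "\<lambda>u. if u = 0\<^sub>v n then 0 else 1 :: bit"
    let ?f = "\<lambda>u. append_bits u [?h u, ?h u, 0]"
    have "?Z = ?f ` ?U S\<^sub>2"
    proof (rule Zeq)
      show "?f ` ?U S\<^sub>2 \<subseteq> carrier_vec (n + 3)" using S by (auto intro!: append_bits3_carrier)
      fix u :: "bit vec" and a b c assume u: "u \<in> carrier_vec n"
      have "append_bits u [a, b, c] \<in> ?f ` ?U S\<^sub>2 \<longleftrightarrow>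
          u \<in> ?U S\<^sub>2 \<and> a = ?h u \<and> b = ?h u \<and> c = 0"
        using S(2) u by (auto simp: image_iff append_bits3_inject[of _ n] subset_iff)
      then show "append_bits u [a, b, c] \<in> ?Z \<longleftrightarrow> append_bits u [a, b, c] \<in> ?f ` ?U S\<^sub>2"
        unfolding memZ[OF u] append_bits_in_diamond_iff[OF S u] using 4 z by (auto split: if_splits)
    qed
    moreover have "inj_on ?f (?U S\<^sub>2)"
      by (rule inj_onI) (use S in \<open>auto simp: append_bits3_inject[of _ n] subset_iff\<close>)
    ultimately have "card ?Z = card (?U S\<^sub>2)" by (simp add: card_image)
    then show ?thesis using P2 unfolding powerful_set_def by simp
  qed
qed

lemma card_diamond:
  assumes "S\<^sub>1 \<subseteq> carrier_vec n" "S\<^sub>2 \<subseteq> carrier_vec n"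
  shows "card (diamond n S\<^sub>1 S\<^sub>2) = 2 ^ (n + 1)"
  using card_vanishing_diamond_free[OF assms, of "{}"] by simp

section \<open>Particular members of the diamond, loops and frames\<close>

lemma loopless_nonzero_entry:
  assumes "loopless n S" "e < n"
  obtains u where "u \<in> S" "u $ e = 1"
  using assms by (auto simp: loopless_def loop_of_def)

lemma diamond_member_ex:
  assumes "S\<^sub>1 \<subseteq> carrier_vec n" "S\<^sub>2 \<subseteq> carrier_vec n" "u \<in> carrier_vec n"
  obtains b c where "append_bits u [a, b, c] \<in> diamond n S\<^sub>1 S\<^sub>2"
  using append_bits_in_diamond_iff[OF assms] by blast

lemma diamond_member_S1:
  assumes "S\<^sub>1 \<subseteq> carrier_vec n" "S\<^sub>2 \<subseteq> carrier_vec n" "u \<in> S\<^sub>1" "u \<noteq> 0\<^sub>v n"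
  shows "append_bits u [0, 0, 1] \<in> diamond n S\<^sub>1 S\<^sub>2"
  using append_bits_in_diamond_iff[OF assms(1,2), of u 0 0 1] assms by auto

lemma diamond_member_S2:
  assumes "S\<^sub>1 \<subseteq> carrier_vec n" "S\<^sub>2 \<subseteq> carrier_vec n" "u \<in> S\<^sub>2" "u \<noteq> 0\<^sub>v n"
  shows "append_bits u [1, 1, 0] \<in> diamond n S\<^sub>1 S\<^sub>2"
  using append_bits_in_diamond_iff[OF assms(1,2), of u 1 1 0] assms by auto

lemma diamond_member_ones:
  assumes "S\<^sub>1 \<subseteq> carrier_vec n" "S\<^sub>2 \<subseteq> carrier_vec n"
  shows "append_bits (0\<^sub>v n) [1, 1, 1] \<in> diamond n S\<^sub>1 S\<^sub>2"
  using append_bits_in_diamond_iff[OF assms, of "0\<^sub>v n" 1 1 1] by auto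

text \<open>Only the last three positions are constrained, so an isomorphism fixing them carries
  this description of the first factor along.\<close>

lemma mem_S1_iff_diamond:
  assumes "S\<^sub>1 \<subseteq> carrier_vec n" "S\<^sub>2 \<subseteq> carrier_vec n" "u \<in> carrier_vec n"
  shows "u \<in> S\<^sub>1 \<longleftrightarrow> (\<exists>c. append_bits u [0, 0, c] \<in> diamond n S\<^sub>1 S\<^sub>2)"
  unfolding append_bits_in_diamond_iff[OF assms] by auto

text \<open>A final bit 0 means that the prefix lies in B, whose nonzero members come from nonzero
  members of \<open>S\<^sub>2\<close>. The zero member of B matches the assumption that
  \<open>S\<^sub>2\<close> contains zero.\<close>

lemma mem_S2_iff_diamond:
  assumes "S\<^sub>1 \<subseteq> carrier_vec n" "S\<^sub>2 \<subseteq> carrier_vec n" "u \<in> carrier_vec n" "0\<^sub>v n \<in> S\<^sub>2"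
  shows "u \<in> S\<^sub>2 \<longleftrightarrow> (\<exists>a b. append_bits u [a, b, 0] \<in> diamond n S\<^sub>1 S\<^sub>2)"
  unfolding append_bits_in_diamond_iff[OF assms(1-3)] using assms(4) by auto

text \<open>The zero at \<open>n + 2\<close> puts the prefix into B, and the zero at
  \<open>n\<close> leaves only the zero prefix. It also lies in A since zero is in
  \<open>S\<^sub>1\<close>, so the remaining bit is 0.\<close>

lemma diamond_eq_zeroI:
  assumes S: "S\<^sub>1 \<subseteq> carrier_vec n" "S\<^sub>2 \<subseteq> carrier_vec n" and z: "0\<^sub>v n \<in> S\<^sub>1"
    and v: "v \<in> diamond n S\<^sub>1 S\<^sub>2" "v $ n = 0" "v $ (n + 2) = 0"
  shows "v = 0\<^sub>v (n + 3)"
proof -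
  have "v \<in> carrier_vec (n + 3)" using v(1) diamond_carrier[OF S] by auto
  then obtain u a b c where u: "u \<in> carrier_vec n" and veq: "v = append_bits u [a, b, c]"
    by (rule append_bits3_exhaust)
  have "a = 0" "c = 0" using v(2,3) by (auto simp: veq append_bits3_index[OF u])
  with v(1) z have "u = 0\<^sub>v n" "b = 0"
    unfolding veq append_bits_in_diamond_iff[OF S u] by (auto split: if_splits)
  then show ?thesis using \<open>a = 0\<close> \<open>c = 0\<close> by (simp add: veq append_bits3_eq_zero_iff)
qed

lemma less_add3_cases:
  fixes e n :: nat
  assumes "e < n + 3"
  obtains "e < n" | "e = n" | "e = n + 1" | "e = n + 2"
  using assms by linarith

text \<open>A member starting with a unit vector handles each position below \<open>n\<close>, and
  the member with prefix zero and final bits 111 handles the last three.\<close>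

lemma loopless_diamond:
  assumes S: "S\<^sub>1 \<subseteq> carrier_vec n" "S\<^sub>2 \<subseteq> carrier_vec n"
  shows "loopless (n + 3) (diamond n S\<^sub>1 S\<^sub>2)"
  unfolding loopless_def
proof
  assume "\<exists>e. loop_of (n + 3) (diamond n S\<^sub>1 S\<^sub>2) e"
  then obtain e where e: "e < n + 3" and z: "\<And>v. v \<in> diamond n S\<^sub>1 S\<^sub>2 \<Longrightarrow> v $ e = 0"
    by (auto simp: loop_of_def)
  obtain b c where m: "append_bits (unit_vec n e) [0, b, c] \<in> diamond n S\<^sub>1 S\<^sub>2"
    by (rule diamond_member_ex[OF S unit_vec_carrier])
  from e show False
    by (cases rule: less_add3_cases)
      (use z[OF m] z[OF diamond_member_ones[OF S]] in \<open>auto simp: append_bits3_index[of _ n]\<close>)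
qed

text \<open>Every position has a nonzero member vanishing there: final bits 111 after zero for
  \<open>e < n\<close>, a unit vector followed by \<open>a = 0\<close> for \<open>e = n\<close>, and
  nonzero members of \<open>S\<^sub>1\<close> and \<open>S\<^sub>2\<close>, supplied by
  looplessness, for the two indicator positions.\<close>

lemma frameless_diamond:
  assumes S: "S\<^sub>1 \<subseteq> carrier_vec n" "S\<^sub>2 \<subseteq> carrier_vec n" and n: "n > 0"
    and L: "loopless n S\<^sub>1" "loopless n S\<^sub>2"
  shows "frameless (n + 3) (diamond n S\<^sub>1 S\<^sub>2)"
  unfolding frameless_def
proof
  assume "\<exists>e. frame_of (n + 3) (diamond n S\<^sub>1 S\<^sub>2) e"
  then obtain e where e: "e < n + 3"
    and one: "\<And>v. v \<in> diamond n S\<^sub>1 S\<^sub>2 \<Longrightarrow> v \<noteq> 0\<^sub>v (n + 3) \<Longrightarrow> v $ e = 1"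
    by (auto simp: frame_of_def)
  obtain x where x: "x \<in> S\<^sub>1" "x $ 0 = 1" using loopless_nonzero_entry[OF L(1) n] .
  obtain y where y: "y \<in> S\<^sub>2" "y $ 0 = 1" using loopless_nonzero_entry[OF L(2) n] .
  have xy: "x \<noteq> 0\<^sub>v n" "y \<noteq> 0\<^sub>v n" "x \<in> carrier_vec n" "y \<in> carrier_vec n"
    using x y n S by auto
  have u0: "unit_vec n 0 \<noteq> (0\<^sub>v n :: bit vec)" using n by (metis index_unit_vec(1) index_zero_vec(1) zero_neq_one)
  obtain b c where m: "append_bits (unit_vec n 0) [0, b, c] \<in> diamond n S\<^sub>1 S\<^sub>2"
    by (rule diamond_member_ex[OF S unit_vec_carrier])
  from e show False
  proof (cases rule: less_add3_cases)
    case 1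
    then show False using one[OF diamond_member_ones[OF S]]
      by (simp add: append_bits3_index[of _ n] append_bits3_eq_zero_iff)
  next
    case 2
    then show False using one[OF m] u0 by (simp add: append_bits3_index[of _ n] append_bits3_eq_zero_iff)
  next
    case 3
    then show False using one[OF diamond_member_S1[OF S x(1) xy(1)]] xy
      by (simp add: append_bits3_index[of _ n] append_bits3_eq_zero_iff)
  next
    case 4
    then show False using one[OF diamond_member_S2[OF S y(1) xy(2)]] xy
      by (simp add: append_bits3_index[of _ n] append_bits3_eq_zero_iff)
  qed
qed

section \<open>Domination between positions, an invariant that locates \<open>n\<close> and
  \<open>n + 1\<close>\<close>

definition dominates :: "bit vec set \<Rightarrow> nat \<Rightarrow> nat \<Rightarrow> bool" where
  "dominates T p e \<longleftrightarrow> (\<forall>v\<in>T. v $ p = 0 \<longrightarrow> v $ e = 0)"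

text \<open>A zero at \<open>n + 1\<close> means that the prefix lies in A, and all members of A end
  in 0.\<close>

lemma diamond_dominates:
  assumes S: "S\<^sub>1 \<subseteq> carrier_vec n" "S\<^sub>2 \<subseteq> carrier_vec n"
  shows "dominates (diamond n S\<^sub>1 S\<^sub>2) (n + 1) n"
  unfolding dominates_def
proof (intro ballI impI)
  fix v assume v: "v \<in> diamond n S\<^sub>1 S\<^sub>2" "v $ (n + 1) = 0"
  have "v \<in> carrier_vec (n + 3)" using v(1) diamond_carrier[OF S] by auto
  then obtain u a b c where u: "u \<in> carrier_vec n" and veq: "v = append_bits u [a, b, c]"
    by (rule append_bits3_exhaust)
  show "v $ n = 0"
    using v unfolding veq append_bits_in_diamond_iff[OF S u]
    by (auto simp: append_bits3_index[OF u] split: if_splits)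
qed

text \<open>For every other pair some member vanishes at \<open>p\<close> but not at
  \<open>e\<close>. Properness of \<open>S\<^sub>1\<close> serves the pair \<open>p = n\<close>,
  \<open>e = n + 1\<close>: if \<open>S\<^sub>1\<close> were everything, \<open>a = 0\<close> would
  force \<open>b = 0\<close>.\<close>

lemma diamond_dominates_unique:
  assumes S: "S\<^sub>1 \<subseteq> carrier_vec n" "S\<^sub>2 \<subseteq> carrier_vec n" and n: "n > 0"
    and L: "loopless n S\<^sub>1" "loopless n S\<^sub>2" and proper: "S\<^sub>1 \<noteq> carrier_vec n"
    and pe: "p < n + 3" "e < n + 3" "p \<noteq> e" and dom: "dominates (diamond n S\<^sub>1 S\<^sub>2) p e"
  shows "p = n + 1 \<and> e = n"
proof (rule ccontr)
  assume other: "\<not> ?thesis"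
  have d: "v $ p = 0 \<Longrightarrow> v $ e = 0" if "v \<in> diamond n S\<^sub>1 S\<^sub>2" for v
    using dom that by (auto simp: dominates_def)
  \<comment> \<open>\<open>k\<close> is \<open>e\<close> where that makes sense; otherwise any position does, since only nonzero vectors are needed.\<close>
  define k where "k = (if e < n then e else 0)"
  have k: "k < n" using n by (auto simp: k_def)
  obtain x where x: "x \<in> S\<^sub>1" "x $ k = 1" using loopless_nonzero_entry[OF L(1) k] .
  obtain y where y: "y \<in> S\<^sub>2" "y $ k = 1" using loopless_nonzero_entry[OF L(2) k] .
  have xy: "x \<noteq> 0\<^sub>v n" "y \<noteq> 0\<^sub>v n" and xc: "x \<in> carrier_vec n" and yc: "y \<in> carrier_vec n"
    using x y k S by auto
  have u0: "unit_vec n k \<noteq> (0\<^sub>v n :: bit vec)" using k by (metis index_unit_vec(1) index_zero_vec(1) zero_neq_one)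
  obtain b c where m: "append_bits (unit_vec n k) [0, b, c] \<in> diamond n S\<^sub>1 S\<^sub>2"
    by (rule diamond_member_ex[OF S unit_vec_carrier])
  \<comment> \<open>A nonzero prefix with \<open>a = 0\<close> lies outside B.\<close>
  have c: "c = 1" using m u0 by (simp add: append_bits_in_diamond_iff[OF S])
  obtain z where zc: "z \<in> carrier_vec n" and z: "z \<notin> S\<^sub>1" using proper S(1) by auto
  obtain b' c' where mz: "append_bits z [0, b', c'] \<in> diamond n S\<^sub>1 S\<^sub>2"
    by (rule diamond_member_ex[OF S zc])
  have b': "b' = 1" using mz z zc by (simp add: append_bits_in_diamond_iff[OF S])
  note ds = d[OF m] d[OF mz] d[OF diamond_member_ones[OF S]]
    d[OF diamond_member_S1[OF S x(1) xy(1)]] d[OF diamond_member_S2[OF S y(1) xy(2)]]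
  note ix = append_bits3_index[OF xc] append_bits3_index[OF yc] append_bits3_index[OF zc]
    append_bits3_index[OF zero_carrier_vec] append_bits3_index[OF unit_vec_carrier]
  \<comment> \<open>Witnesses: for \<open>p < n\<close>, the unit vector member if
    \<open>e < n\<close> and the member with final bits 111 otherwise; for \<open>p = n\<close>, the
    unit vector member, or the one over \<open>z\<close> if \<open>e = n + 1\<close>; for
    \<open>p = n + 1\<close>, the one over \<open>x\<close>; for \<open>p = n + 2\<close>, the one
    over \<open>y\<close>.\<close>
  from pe(1) show False
  proof (cases rule: less_add3_cases)
    case p: 1
    from pe(2) show False
      by (cases rule: less_add3_cases) (use p pe(3) ds(1,3) in \<open>auto simp: ix k_def\<close>)
  next
    case p: 2
    from pe(2) show False
      by (cases rule: less_add3_cases) (use p pe(3) ds(1,2) b' c in \<open>auto simp: ix k_def\<close>)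
  next
    case p: 3
    from pe(2) show False
      by (cases rule: less_add3_cases) (use p pe(3) ds(4) x(2) other in \<open>auto simp: ix k_def\<close>)
  next
    case p: 4
    from pe(2) show False
      by (cases rule: less_add3_cases) (use p pe(3) ds(5) y(2) in \<open>auto simp: ix k_def\<close>)
  qed
qed

section \<open>Relabelling positions and recovering the factors from an isomorphism\<close>

lemma relabel_index:
  assumes "bij_betw \<pi> {..<n} {..<m}" "i < n"
  shows "relabel n m \<pi> v $ \<pi> i = v $ i"
proof -
  have "\<pi> i < m" using assms by (auto simp: bij_betw_def)
  then show ?thesis using assms by (simp add: relabel_def bij_betw_def)
qed

lemma relabel_carrier: "relabel n m \<pi> v \<in> carrier_vec m"
  by (simp add: relabel_def)

lemma inj_on_relabel:
  assumes "bij_betw \<pi> {..<n} {..<m}"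
  shows "inj_on (relabel n m \<pi>) (carrier_vec n)"
proof (rule inj_onI)
  fix u v assume uv: "u \<in> carrier_vec n" "v \<in> carrier_vec n" "relabel n m \<pi> u = relabel n m \<pi> v"
  have "u $ i = v $ i" if "i < n" for i
    using relabel_index[OF assms that, of u] relabel_index[OF assms that, of v] uv(3) by simp
  then show "u = v" using uv by auto
qed

text \<open>An injective self-map of a finite set is onto.\<close>

lemma bij_betw_relabel:
  assumes "bij_betw \<pi> {..<n} {..<n}"
  shows "bij_betw (relabel n n \<pi>) (carrier_vec n) (carrier_vec n)"
proof -
  have "relabel n n \<pi> ` carrier_vec n \<subseteq> carrier_vec n" using relabel_carrier by blast
  then show ?thesis
    using endo_inj_surj[OF finite_carrier_vec_bit _ inj_on_relabel[OF assms]] inj_on_relabel[OF assms]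
    by (simp add: bij_betw_def)
qed

text \<open>Reduces a bijection between two factors to an equivalence of memberships under a
  permutation of the ambient space.\<close>

lemma bij_betw_restrict:
  assumes "bij_betw f C C" "S \<subseteq> C" "S' \<subseteq> C" "\<And>u. u \<in> C \<Longrightarrow> f u \<in> S' \<longleftrightarrow> u \<in> S"
  shows "bij_betw f S S'"
proof -
  have "f ` S = S'"
  proof
    show "f ` S \<subseteq> S'" using assms(2,4) by blast
    show "S' \<subseteq> f ` S"
    proof
      fix w assume w: "w \<in> S'"
      then obtain u where "u \<in> C" "w = f u" using assms(1,3) by (auto simp: bij_betw_def)
      then show "w \<in> f ` S" using w assms(4) by blast
    qed
  qed
  then show ?thesis using assms(1,2) inj_on_subset by (auto simp: bij_betw_def)
qed

text \<open>Domination is found in the source diamond and its uniqueness is applied in the target,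
  so looplessness and properness are asked of the primed factors.\<close>

lemma isomorphic_diamond_factors:
  assumes n: "n \<ge> 2"
    and P: "powerful_set n S\<^sub>1" "powerful_set n S\<^sub>2" "powerful_set n S\<^sub>1'" "powerful_set n S\<^sub>2'"
    and L: "loopless n S\<^sub>1'" "loopless n S\<^sub>2'" and proper: "S\<^sub>1' \<noteq> carrier_vec n"
    and iso: "isomorphic_sets (n + 3) (diamond n S\<^sub>1 S\<^sub>2) (n + 3) (diamond n S\<^sub>1' S\<^sub>2')"
  shows "isomorphic_sets n S\<^sub>1 n S\<^sub>1' \<and> isomorphic_sets n S\<^sub>2 n S\<^sub>2'"
proof -
  let ?T = "diamond n S\<^sub>1 S\<^sub>2" and ?T' = "diamond n S\<^sub>1' S\<^sub>2'"
  have S: "S\<^sub>1 \<subseteq> carrier_vec n" "S\<^sub>2 \<subseteq> carrier_vec n" and S': "S\<^sub>1' \<subseteq> carrier_vec n" "S\<^sub>2' \<subseteq> carrier_vec n"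
    using P by (auto simp: powerful_set_def)
  obtain \<pi> where \<pi>: "bij_betw \<pi> {..<n + 3} {..<n + 3}"
    and R: "bij_betw (relabel (n + 3) (n + 3) \<pi>) ?T ?T'"
    using iso by (auto simp: isomorphic_sets_def)
  let ?R = "relabel (n + 3) (n + 3) \<pi>" and ?r = "relabel n n \<pi>"
  have T': "?T' = ?R ` ?T" using R by (simp add: bij_betw_def)
  have \<pi>_less: "\<pi> i < n + 3" if "i < n + 3" for i using \<pi> that by (auto simp: bij_betw_def)
  have \<pi>_inj: "\<pi> i \<noteq> \<pi> j" if "i < n + 3" "j < n + 3" "i \<noteq> j" for i j
    using \<pi> that by (auto simp: bij_betw_def inj_on_def)
  note ix = relabel_index[OF \<pi>]
  \<comment> \<open>An isomorphism carries a dominating pair to a dominating pair, and the target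
    has only one with distinct positions.\<close>
  have "dominates ?T' (\<pi> (n + 1)) (\<pi> n)"
    using diamond_dominates[OF S] by (auto simp: dominates_def T' ix)
  then have fix1: "\<pi> (n + 1) = n + 1" and fix0: "\<pi> n = n"
    using diamond_dominates_unique[OF S' _ L proper, of "\<pi> (n + 1)" "\<pi> n"]
      \<pi>_less[of n] \<pi>_less[of "n + 1"] \<pi>_inj[of "n + 1" n] n by auto
  have fix2: "\<pi> (n + 2) = n + 2"
  proof (rule ccontr)
    assume "\<pi> (n + 2) \<noteq> n + 2"
    then have p: "\<pi> (n + 2) < n"
      using \<pi>_less[of "n + 2"] \<pi>_inj[of "n + 2" n] \<pi>_inj[of "n + 2" "n + 1"] fix0 fix1 by auto
    \<comment> \<open>A position below \<open>n\<close> other than \<open>\<pi> (n + 2)\<close>,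
      which exists because \<open>n \<ge> 2\<close>.\<close>
    define q where "q = (if \<pi> (n + 2) = 0 then 1 else 0 :: nat)"
    have q: "q < n" "q \<noteq> \<pi> (n + 2)" using n by (auto simp: q_def)
    obtain b c where m: "append_bits (unit_vec n q) [0, b, c] \<in> ?T'"
      by (rule diamond_member_ex[OF S' unit_vec_carrier])
    then obtain v where v: "v \<in> ?T" and eq: "append_bits (unit_vec n q) [0, b, c] = ?R v"
      by (auto simp: T')
    \<comment> \<open>The chosen member of the target vanishes at \<open>n\<close> and at
      \<open>\<pi> (n + 2)\<close>, so its preimage \<open>v\<close> vanishes at \<open>n\<close>
      and \<open>n + 2\<close> and is therefore zero. This contradicts the entry 1 at
      \<open>q\<close>.\<close>
    have "v $ n = 0"
      using ix[of n v] unfolding fix0 eq[symmetric] by (simp add: append_bits3_index[of _ n])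
    moreover have "v $ (n + 2) = 0"
      using ix[of "n + 2" v] p q unfolding eq[symmetric] by (simp add: append_bits3_index[of _ n])
    ultimately have v0: "v = 0\<^sub>v (n + 3)"
      using diamond_eq_zeroI[OF S powerful_set_zero[OF P(1)] v] by simp
    have "q \<in> \<pi> ` {..<n + 3}" using \<pi> q by (simp add: bij_betw_def)
    then obtain i where i: "i < n + 3" "\<pi> i = q" by auto
    have "append_bits (unit_vec n q) [0, b, c] $ q = 0"
      using ix[OF i(1), of v] i unfolding eq by (simp add: v0)
    then show False using q by (simp add: append_bits3_index[of _ n])
  qed
  have split: "{..<n} = {..<n + 3} - {n, n + 1, n + 2}" by auto
  have "\<pi> ` {..<n} = \<pi> ` {..<n + 3} - \<pi> ` {n, n + 1, n + 2}"
    unfolding split by (rule inj_on_image_set_diff[of _ "{..<n + 3}"]) (use \<pi> in \<open>auto simp: bij_betw_def\<close>)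
  also have "\<dots> = {..<n}"
    using \<pi> fix0 fix1 fix2 unfolding split by (simp add: bij_betw_def)
  finally have \<pi>n: "bij_betw \<pi> {..<n} {..<n}"
    using \<pi> by (auto simp: bij_betw_def inj_on_def)
  \<comment> \<open>Since \<open>\<pi>\<close> fixes the last three positions, relabelling acts on
    the prefix alone and keeps the appended bits.\<close>
  have Rr: "?R (append_bits u [a, b, c]) = append_bits (?r u) [a, b, c]" if u: "u \<in> carrier_vec n" for u a b c
  proof (rule eq_vecI)
    show "dim_vec (?R (append_bits u [a, b, c])) = dim_vec (append_bits (?r u) [a, b, c])"
      using append_bits3_carrier[OF relabel_carrier[of n n \<pi> u], of a b c] by (simp add: relabel_def)
    fix j assume "j < dim_vec (append_bits (?r u) [a, b, c])"
    then have "j < n + 3" using append_bits3_carrier[OF relabel_carrier[of n n \<pi> u], of a b c] by simp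
    then have "j \<in> \<pi> ` {..<n + 3}" using \<pi> by (simp add: bij_betw_def)
    then obtain i where i: "i < n + 3" "j = \<pi> i" by auto
    have "append_bits u [a, b, c] $ i = append_bits (?r u) [a, b, c] $ \<pi> i"
      using i(1)
    proof (cases rule: less_add3_cases)
      case 1
      then have "\<pi> i < n" using \<pi>n by (auto simp: bij_betw_def)
      then show ?thesis
        using 1 by (simp add: append_bits3_index[OF u] append_bits3_index[OF relabel_carrier] relabel_index[OF \<pi>n])
    qed (use fix0 fix1 fix2 in \<open>simp_all add: append_bits3_index[OF u] append_bits3_index[OF relabel_carrier]\<close>)
    then show "?R (append_bits u [a, b, c]) $ j = append_bits (?r u) [a, b, c] $ j"
      using ix[OF i(1)] i(2) by simp
  qed
  have memR: "?R v \<in> ?T' \<longleftrightarrow> v \<in> ?T" if "v \<in> carrier_vec (n + 3)" for v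
    unfolding T' using inj_on_image_mem_iff[OF inj_on_relabel[OF \<pi>] that diamond_carrier[OF S]] .
  have mem: "append_bits (?r u) [a, b, c] \<in> ?T' \<longleftrightarrow> append_bits u [a, b, c] \<in> ?T"
    if "u \<in> carrier_vec n" for u a b c
    using memR[OF append_bits3_carrier[OF that]] by (simp add: Rr[OF that])
  have "bij_betw ?r S\<^sub>1 S\<^sub>1'"
    by (rule bij_betw_restrict[OF bij_betw_relabel[OF \<pi>n] S(1) S'(1)])
      (simp add: mem_S1_iff_diamond[OF S] mem_S1_iff_diamond[OF S' relabel_carrier] mem)
  moreover have "bij_betw ?r S\<^sub>2 S\<^sub>2'"
    by (rule bij_betw_restrict[OF bij_betw_relabel[OF \<pi>n] S(2) S'(2)])
      (simp add: mem_S2_iff_diamond[OF S _ powerful_set_zero[OF P(2)]]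
        mem_S2_iff_diamond[OF S' relabel_carrier powerful_set_zero[OF P(4)]] mem)
  ultimately show ?thesis using \<pi>n unfolding isomorphic_sets_def by blast
qed

section \<open>Nonlinearity\<close>

lemma diamond_not_linear:
  assumes P: "powerful_set n S\<^sub>1" and S2: "S\<^sub>2 \<subseteq> carrier_vec n" and card: "card S\<^sub>1 > 2"
  shows "\<not> linear_set (n + 3) (diamond n S\<^sub>1 S\<^sub>2)"
proof
  let ?T = "diamond n S\<^sub>1 S\<^sub>2"
  assume "linear_set (n + 3) ?T"
  then have "submodule class_ring ?T (module_vec TYPE(bit) (n + 3))"
    by (simp add: linear_set_def subspace_def)
  from LinearCombinations.submodule.m_closed[OF this]
  have add: "v + w \<in> ?T" if "v \<in> ?T" "w \<in> ?T" for v w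
    using that by (simp add: module_vec_simps)
  have S1: "S\<^sub>1 \<subseteq> carrier_vec n" using P by (simp add: powerful_set_def)
  note S = S1 S2
  \<comment> \<open>More than two elements leave room for two distinct nonzero ones.\<close>
  have "\<not> S\<^sub>1 \<subseteq> {0\<^sub>v n}" using card card_mono[of "{0\<^sub>v n}" S\<^sub>1] by auto
  then obtain x where x: "x \<in> S\<^sub>1" "x \<noteq> 0\<^sub>v n" by auto
  have "\<not> S\<^sub>1 \<subseteq> {0\<^sub>v n, x}" using card card_mono[of "{0\<^sub>v n, x}" S\<^sub>1] x by auto
  then obtain y where y: "y \<in> S\<^sub>1" "y \<noteq> 0\<^sub>v n" "y \<noteq> x" by auto
  let ?v = "append_bits x [0, 0, 1]" and ?w = "append_bits y [0, 0, 1]"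
  have xc: "x \<in> carrier_vec n" and yc: "y \<in> carrier_vec n" using x y S1 by auto
  have dim: "dim_vec ?v = n + 3" "dim_vec ?w = n + 3"
    using append_bits3_carrier[OF xc] append_bits3_carrier[OF yc] by auto
  note ix = append_bits3_index[OF xc] append_bits3_index[OF yc]
  have "?v + ?w \<in> ?T" by (rule add; rule diamond_member_S1[OF S]) (use x y in auto)
  \<comment> \<open>The final bits 1 cancel, so the sum is a member vanishing at \<open>n\<close>
    and \<open>n + 2\<close>, and such a member is zero.\<close>
  then have zero: "?v + ?w = 0\<^sub>v (n + 3)"
    by (rule diamond_eq_zeroI[OF S powerful_set_zero[OF P]]) (simp_all add: dim ix)
  have "x $ i = y $ i" if "i < n" for i
  proof -
    have "(?v + ?w) $ i = 0" using that by (simp add: zero)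
    then have "x $ i + y $ i = 0" using that by (simp add: dim ix)
    then show ?thesis by (cases "x $ i"; cases "y $ i") auto
  qed
  then have "x = y" using xc yc by auto
  with y(3) show False by simp
qed

section \<open>Diamonds over the whole family\<close>

theorem theorem14:
  fixes n :: nat and \<S> :: "bit vec set set"
  assumes "n \<ge> 2"
    and "\<And>S. S \<in> \<S> \<Longrightarrow>
           powerful_set n S \<and> loopless n S \<and> frameless n S \<and> card S = 2 ^ (n - 2)"
    and "pairwise_nonisomorphic n \<S>"
  shows "(\<forall>T \<in> diamond_square n \<S>.
            powerful_set (n + 3) T \<and> loopless (n + 3) T \<and> frameless (n + 3) T \<and>
            card T = 2 ^ (n + 1)) \<and>
         pairwise_nonisomorphic (n + 3) (diamond_square n \<S>) \<and>
         (\<forall>S\<^sub>1 \<in> \<S>. \<forall>S\<^sub>2 \<in> \<S>. \<forall>S\<^sub>1' \<in> \<S>. \<forall>S\<^sub>2' \<in> \<S>.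
            isomorphic_sets (n + 3) (diamond n S\<^sub>1 S\<^sub>2) (n + 3) (diamond n S\<^sub>1' S\<^sub>2') \<longrightarrow>
            isomorphic_sets n S\<^sub>1 n S\<^sub>1' \<and> isomorphic_sets n S\<^sub>2 n S\<^sub>2') \<and>
         (n > 3 \<longrightarrow> (\<forall>T \<in> diamond_square n \<S>. \<not> linear_set (n + 3) T))"
proof -
  have P: "powerful_set n S" and L: "loopless n S" and card: "card S = 2 ^ (n - 2)"
    and C: "S \<subseteq> carrier_vec n" if "S \<in> \<S>" for S
    using assms(2)[OF that] by (auto simp: powerful_set_def)
  have proper: "S \<noteq> carrier_vec n" if "S \<in> \<S>" for S
  proof
    assume "S = carrier_vec n"
    \<comment> \<open>The exponents differ: because \<open>n \<ge> 2\<close>, the subtraction is not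
      truncated.\<close>
    then have "(2::nat) ^ n = 2 ^ (n - 2)" using card[OF that] card_carrier_vec_bit[of n] by simp
    then show False using assms(1) by simp
  qed
  have factors: "isomorphic_sets n S\<^sub>1 n S\<^sub>1' \<and> isomorphic_sets n S\<^sub>2 n S\<^sub>2'"
    if "S\<^sub>1 \<in> \<S>" "S\<^sub>2 \<in> \<S>" "S\<^sub>1' \<in> \<S>" "S\<^sub>2' \<in> \<S>"
      "isomorphic_sets (n + 3) (diamond n S\<^sub>1 S\<^sub>2) (n + 3) (diamond n S\<^sub>1' S\<^sub>2')" for S\<^sub>1 S\<^sub>2 S\<^sub>1' S\<^sub>2'
    by (rule isomorphic_diamond_factors[OF assms(1) P P P P L L proper]) (fact that)+
  have members: "powerful_set (n + 3) T \<and> loopless (n + 3) T \<and> frameless (n + 3) T \<and> card T = 2 ^ (n + 1)"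
    if mem: "T \<in> diamond_square n \<S>" for T
  proof -
    obtain S\<^sub>1 S\<^sub>2 where T: "T = diamond n S\<^sub>1 S\<^sub>2" and m: "S\<^sub>1 \<in> \<S>" "S\<^sub>2 \<in> \<S>"
      using mem unfolding diamond_square_def by blast
    show ?thesis unfolding T
      using powerful_diamond[OF P[OF m(1)] P[OF m(2)]] loopless_diamond[OF C[OF m(1)] C[OF m(2)]]
        frameless_diamond[OF C[OF m(1)] C[OF m(2)] _ L[OF m(1)] L[OF m(2)]]
        card_diamond[OF C[OF m(1)] C[OF m(2)]] assms(1) by simp
  qed
  have noniso: "pairwise_nonisomorphic (n + 3) (diamond_square n \<S>)"
    unfolding pairwise_nonisomorphic_def
  proof (intro ballI impI notI)
    fix T T' assume T: "T \<in> diamond_square n \<S>" "T' \<in> diamond_square n \<S>" "T \<noteq> T'"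
      and iso: "isomorphic_sets (n + 3) T (n + 3) T'"
    obtain S\<^sub>1 S\<^sub>2 S\<^sub>1' S\<^sub>2' where eq: "T = diamond n S\<^sub>1 S\<^sub>2" "T' = diamond n S\<^sub>1' S\<^sub>2'"
      and m: "S\<^sub>1 \<in> \<S>" "S\<^sub>2 \<in> \<S>" "S\<^sub>1' \<in> \<S>" "S\<^sub>2' \<in> \<S>"
      using T(1,2) unfolding diamond_square_def by blast
    \<comment> \<open>Isomorphic members of the family are equal, so equal factors give equal
      diamonds.\<close>
    then have "S\<^sub>1 = S\<^sub>1'" "S\<^sub>2 = S\<^sub>2'"
      using factors[OF m] iso assms(3) by (auto simp: pairwise_nonisomorphic_def)
    then show False using T(3) eq by simp
  qed
  have nonlinear: "\<not> linear_set (n + 3) T" if large: "n > 3" and mem: "T \<in> diamond_square n \<S>" for T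
  proof -
    obtain S\<^sub>1 S\<^sub>2 where T: "T = diamond n S\<^sub>1 S\<^sub>2" and m: "S\<^sub>1 \<in> \<S>" "S\<^sub>2 \<in> \<S>"
      using mem unfolding diamond_square_def by blast
    \<comment> \<open>For \<open>n > 3\<close> the factor has at least four elements, which exceeds
      the required two.\<close>
    have "(2::nat) ^ 2 \<le> 2 ^ (n - 2)" using large by (intro power_increasing) auto
    then show ?thesis
      unfolding T using card[OF m(1)] by (intro diamond_not_linear[OF P[OF m(1)] C[OF m(2)]]) simp
  qed
  show ?thesis using members noniso factors nonlinear by blast
qed

end
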